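(* Any transitive distributive binary $G$-space $X$, where $G$ is a compact topological group, is biequivariantly homeomorphic to the space of cosets $G/H$ by some closed normal subgroup $H$ of the group $G$, with the binary action of $G$ on $G/H$ given by \[ g(kH,lH)=(kgk^{-1}l)H,\qquad g,k,l\in G. \]
   Context: Let $G$ be a topological group with identity $e$ and $X$ a topological space. A binary action of $G$ on $X$ is a continuous map $\alpha:G\times X^2\to X$, written $g(x,y)=\alpha(g,x,y)$, such that $gh(x,y)=g(x,h(x,y))$ and $e(x,y)=y$ for all $g,h\in G$ and $x,y\in X$ (here $gh(x,y)$ means $(gh)(x,y)$). A space $X$ with a fixed binary action of $G$ is called a binary $G$-space. It is called distributive if $g(x,h(y,z))=h(g(x,y),g(x,z))$ for all $x,y,z\in X$ and $g,h\in G$. It is called transitive if $G(x,x)=X$ for all $x\in X$, where $G(x,x)=\{g(x,x) : g\in G\}$. A continuous map $f:X\to Y$ between binary $G$-spaces is called biequivariant if $f(g(x,y))=g(f(x),f(y))$ for all $g\in G$ and $x,y\in X$; $X$ and $Y$ are biequivariantly homeomorphic if there is a biequivariant map between them that is a homeomorphism. For a closed normal subgroup $H$ of $G$, $G/H$ carries the quotient topology, and the displayed formula is a well-defined distributive binary action of $G$ on $G/H$.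
   Formalization: The space X is additionally assumed to be nonempty and T1 (points are closed); both are necessary, since G/H with H closed is always nonempty and T1, and the claim fails e.g. for a nontrivial finite discrete G acting on itself with the indiscrete topology. *)

theory Defs
  imports "HOL-Analysis.Analysis" "HOL-Algebra.Coset" "HOL-Algebra.Left_Coset"
begin

locale topological_group = group G for G (structure) +
  fixes T :: "'a topology"
  assumes topspace_eq: "topspace T = carrier G"
    and continuous_mult: "continuous_map (prod_topology T T) T (\<lambda>(g, h). g \<otimes> h)"
    and continuous_inv: "continuous_map T T (\<lambda>g. inv g)"

locale binary_G_space = topological_group G T
  for G (structure) and T :: "'a topology" +
  fixes X :: "'x topology" and act :: "'a \<Rightarrow> 'x \<Rightarrow> 'x \<Rightarrow> 'x"
  assumes continuous_act:
      "continuous_map (prod_topology T (prod_topology X X)) X (\<lambda>(g, x, y). act g x y)"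
    and act_mult:
      "\<lbrakk>g \<in> carrier G; h \<in> carrier G; x \<in> topspace X; y \<in> topspace X\<rbrakk>
        \<Longrightarrow> act (g \<otimes> h) x y = act g x (act h x y)"
    and act_one: "\<lbrakk>x \<in> topspace X; y \<in> topspace X\<rbrakk> \<Longrightarrow> act \<one> x y = y"

definition distributive_action ::
    "('a, 'm) monoid_scheme \<Rightarrow> 'x topology \<Rightarrow> ('a \<Rightarrow> 'x \<Rightarrow> 'x \<Rightarrow> 'x) \<Rightarrow> bool" where
  "distributive_action G X act \<longleftrightarrow>
    (\<forall>g\<in>carrier G. \<forall>h\<in>carrier G. \<forall>x\<in>topspace X. \<forall>y\<in>topspace X. \<forall>z\<in>topspace X.
      act g x (act h y z) = act h (act g x y) (act g x z))"

(* Vacuously true when X is empty. *)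
definition transitive_action ::
    "('a, 'm) monoid_scheme \<Rightarrow> 'x topology \<Rightarrow> ('a \<Rightarrow> 'x \<Rightarrow> 'x \<Rightarrow> 'x) \<Rightarrow> bool" where
  "transitive_action G X act \<longleftrightarrow>
    (\<forall>x\<in>topspace X. (\<lambda>g. act g x x) ` carrier G = topspace X)"

definition biequivariant_map ::
    "('a, 'm) monoid_scheme \<Rightarrow> 'x topology \<Rightarrow> ('a \<Rightarrow> 'x \<Rightarrow> 'x \<Rightarrow> 'x)
      \<Rightarrow> 'y topology \<Rightarrow> ('a \<Rightarrow> 'y \<Rightarrow> 'y \<Rightarrow> 'y) \<Rightarrow> ('x \<Rightarrow> 'y) \<Rightarrow> bool" where
  "biequivariant_map G X act Y act' f \<longleftrightarrow>
    continuous_map X Y f \<and>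
    (\<forall>g\<in>carrier G. \<forall>x\<in>topspace X. \<forall>y\<in>topspace X.
      f (act g x y) = act' g (f x) (f y))"

definition biequivariantly_homeomorphic ::
    "('a, 'm) monoid_scheme \<Rightarrow> 'x topology \<Rightarrow> ('a \<Rightarrow> 'x \<Rightarrow> 'x \<Rightarrow> 'x)
      \<Rightarrow> 'y topology \<Rightarrow> ('a \<Rightarrow> 'y \<Rightarrow> 'y \<Rightarrow> 'y) \<Rightarrow> bool" where
  "biequivariantly_homeomorphic G X act Y act' \<longleftrightarrow>
    (\<exists>f. biequivariant_map G X act Y act' f \<and> homeomorphic_map X Y f)"

definition coset_topology ::
    "('a, 'm) monoid_scheme \<Rightarrow> 'a topology \<Rightarrow> 'a set \<Rightarrow> 'a set topology" where
  "coset_topology G T H =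
    topology (\<lambda>U. U \<subseteq> lcosets\<^bsub>G\<^esub> H \<and> openin T {g \<in> topspace T. g <#\<^bsub>G\<^esub> H \<in> U})"

(* The description is independent of the representatives k, l only for normal H;
   see coset_action_eq. *)
definition coset_action ::
    "('a, 'm) monoid_scheme \<Rightarrow> 'a set \<Rightarrow> 'a \<Rightarrow> 'a set \<Rightarrow> 'a set \<Rightarrow> 'a set" where
  "coset_action G H g A B =
    (THE C. \<exists>k\<in>carrier G. \<exists>l\<in>carrier G. A = k <#\<^bsub>G\<^esub> H \<and> B = l <#\<^bsub>G\<^esub> H \<and>
      C = (k \<otimes>\<^bsub>G\<^esub> g \<otimes>\<^bsub>G\<^esub> inv\<^bsub>G\<^esub> k \<otimes>\<^bsub>G\<^esub> l) <#\<^bsub>G\<^esub> H)"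

lemma openin_coset_topology:
  "openin (coset_topology G T H) U \<longleftrightarrow>
    U \<subseteq> lcosets\<^bsub>G\<^esub> H \<and> openin T {g \<in> topspace T. g <#\<^bsub>G\<^esub> H \<in> U}"
proof -
  have "istopology (\<lambda>U. U \<subseteq> lcosets\<^bsub>G\<^esub> H \<and> openin T {g \<in> topspace T. g <#\<^bsub>G\<^esub> H \<in> U})"
    unfolding istopology_def
  proof (intro conjI allI impI)
    fix S U
    assume "S \<subseteq> lcosets\<^bsub>G\<^esub> H \<and> openin T {g \<in> topspace T. g <#\<^bsub>G\<^esub> H \<in> S}"
      and "U \<subseteq> lcosets\<^bsub>G\<^esub> H \<and> openin T {g \<in> topspace T. g <#\<^bsub>G\<^esub> H \<in> U}"
    moreover have "{g \<in> topspace T. g <#\<^bsub>G\<^esub> H \<in> S \<inter> U} =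
        {g \<in> topspace T. g <#\<^bsub>G\<^esub> H \<in> S} \<inter> {g \<in> topspace T. g <#\<^bsub>G\<^esub> H \<in> U}"
      by auto
    ultimately show "openin T {g \<in> topspace T. g <#\<^bsub>G\<^esub> H \<in> S \<inter> U}" "S \<inter> U \<subseteq> lcosets\<^bsub>G\<^esub> H"
      by auto
  next
    fix K
    assume K: "\<forall>S\<in>K. S \<subseteq> lcosets\<^bsub>G\<^esub> H \<and> openin T {g \<in> topspace T. g <#\<^bsub>G\<^esub> H \<in> S}"
    have "{g \<in> topspace T. g <#\<^bsub>G\<^esub> H \<in> \<Union>K} =
        (\<Union>S\<in>K. {g \<in> topspace T. g <#\<^bsub>G\<^esub> H \<in> S})"
      by auto
    then show "openin T {g \<in> topspace T. g <#\<^bsub>G\<^esub> H \<in> \<Union>K}"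
      using K by auto
    show "\<Union>K \<subseteq> lcosets\<^bsub>G\<^esub> H"
      using K by blast
  qed
  then show ?thesis
    by (simp add: coset_topology_def topology_inverse')
qed

context topological_group
begin

lemma topspace_coset_topology: "topspace (coset_topology G T H) = lcosets H"
proof
  show "topspace (coset_topology G T H) \<subseteq> lcosets H"
    using openin_coset_topology openin_topspace by blast
  have "{g \<in> topspace T. g <# H \<in> lcosets H} = topspace T"
    by (auto simp: LCOSETS_def topspace_eq)
  then show "lcosets H \<subseteq> topspace (coset_topology G T H)"
    by (simp add: openin_coset_topology openin_subset)
qed

lemma quotient_map_coset: "quotient_map T (coset_topology G T H) (\<lambda>g. g <# H)"
  unfolding quotient_map_def
  by (auto simp: topspace_coset_topology openin_coset_topology LCOSETS_def topspace_eq)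

lemma open_map_coset:
  assumes H: "subgroup H G"
  shows "open_map T (coset_topology G T H) (\<lambda>g. g <# H)"
  unfolding open_map_def
proof (intro allI impI)
  fix U
  assume U: "openin T U"
  then have UG: "U \<subseteq> carrier G"
    using openin_subset topspace_eq by blast
  have HG: "H \<subseteq> carrier G"
    using H subgroup.subset by blast
  have "{g \<in> topspace T. g <# H \<in> (\<lambda>g. g <# H) ` U} = (\<Union>h\<in>H. {g \<in> topspace T. g \<otimes> h \<in> U})"
  proof (intro equalityI subsetI)
    fix g
    assume "g \<in> {g \<in> topspace T. g <# H \<in> (\<lambda>g. g <# H) ` U}"
    then obtain u where u: "g \<in> carrier G" "u \<in> U" "g <# H = u <# H"
      by (auto simp: topspace_eq)
    then have "u \<in> g <# H"
      using lcos_self[OF _ H, of u] UG by auto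
    then show "g \<in> (\<Union>h\<in>H. {g \<in> topspace T. g \<otimes> h \<in> U})"
      using u by (auto simp: l_coset_def topspace_eq)
  next
    fix g
    assume "g \<in> (\<Union>h\<in>H. {g \<in> topspace T. g \<otimes> h \<in> U})"
    then obtain h where h: "h \<in> H" "g \<in> carrier G" "g \<otimes> h \<in> U"
      by (auto simp: topspace_eq)
    have "(g \<otimes> h) <# H = g <# (h <# H)"
      using lcos_m_assoc[OF HG h(2), of h] h HG by auto
    also have "h <# H = H"
      using h H subgroup.lcos_module_rev[OF H is_group]
      by (metis coset_join3 subgroup.mem_carrier)
    finally show "g \<in> {g \<in> topspace T. g <# H \<in> (\<lambda>g. g <# H) ` U}"
      using h imageI[OF h(3), of "\<lambda>g. g <# H"] by (simp add: topspace_eq)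
  qed
  moreover have "openin T {g \<in> topspace T. g \<otimes> h \<in> U}" if "h \<in> H" for h
  proof -
    have "continuous_map T (prod_topology T T) (\<lambda>g. (g, h))"
      using that HG by (auto simp: continuous_map_pairwise o_def topspace_eq)
    from continuous_map_compose[OF this continuous_mult]
    have "continuous_map T T (\<lambda>g. g \<otimes> h)"
      by (simp add: o_def)
    then show ?thesis
      using U by (simp add: continuous_map_def)
  qed
  ultimately have "openin T {g \<in> topspace T. g <# H \<in> (\<lambda>g. g <# H) ` U}"
    by auto
  then show "openin (coset_topology G T H) ((\<lambda>g. g <# H) ` U)"
    using UG by (auto simp: openin_coset_topology LCOSETS_def)
qed

lemma coset_action_eq:
  assumes H: "H \<lhd> G" and g: "g \<in> carrier G" and k: "k \<in> carrier G" and l: "l \<in> carrier G"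
  shows "coset_action G H g (k <# H) (l <# H) = (k \<otimes> g \<otimes> inv k \<otimes> l) <# H"
proof -
  interpret N: normal H G by (rule H)
  interpret Q: group "G Mod H" by (rule N.factorgroup_is_group)
  interpret q: group_hom G "G Mod H" "\<lambda>a. H #> a"
    by (unfold_locales) (rule N.r_coset_hom_Mod)
  have lr: "a <# H = H #> a" if "a \<in> carrier G" for a
    using that N.coset_eq by simp
  have "H #> (k' \<otimes> g \<otimes> inv k' \<otimes> l') = H #> (k \<otimes> g \<otimes> inv k \<otimes> l)"
    if "k' \<in> carrier G" "l' \<in> carrier G" "H #> k' = H #> k" "H #> l' = H #> l" for k' l'
    using that g k l by (simp del: mult_FactGroup)
  then show ?thesis
    unfolding coset_action_def using g k l
    by (intro the_equality) (auto simp: lr)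
qed

end

lemma open_map_prod_topology:
  assumes f: "open_map X X' f" and g: "open_map Y Y' g"
  shows "open_map (prod_topology X Y) (prod_topology X' Y') (\<lambda>(x, y). (f x, g y))"
  unfolding open_map_def
proof (intro allI impI)
  fix W
  assume W: "openin (prod_topology X Y) W"
  show "openin (prod_topology X' Y') ((\<lambda>(x, y). (f x, g y)) ` W)"
    unfolding openin_prod_topology_alt
  proof (intro allI impI)
    fix a b
    assume "(a, b) \<in> (\<lambda>(x, y). (f x, g y)) ` W"
    then obtain x y where xy: "(x, y) \<in> W" "a = f x" "b = g y"
      by auto
    then obtain U V where "openin X U" "openin Y V" "x \<in> U" "y \<in> V" "U \<times> V \<subseteq> W"
      using W unfolding openin_prod_topology_alt by meson
    then show "\<exists>U V. openin X' U \<and> openin Y' V \<and> a \<in> U \<and> b \<in> V \<and>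
        U \<times> V \<subseteq> (\<lambda>(x, y). (f x, g y)) ` W"
      using f g xy unfolding open_map_def
      by (intro exI[of _ "f ` U"] exI[of _ "g ` V"]) force
  qed
qed

context topological_group
begin

lemma continuous_map_mult [continuous_intros]:
  assumes "continuous_map Z T f" "continuous_map Z T f'"
  shows "continuous_map Z T (\<lambda>z. f z \<otimes> f' z)"
  using continuous_map_compose[OF _ continuous_mult, of Z "\<lambda>z. (f z, f' z)"] assms
  by (simp add: o_def continuous_map_pairwise)

lemma binary_G_space_coset:
  assumes H: "H \<lhd> G"
  shows "binary_G_space G T (coset_topology G T H) (coset_action G H)"
proof (unfold_locales, goal_cases)
  case 1
  let ?C = "coset_topology G T H"
  let ?q = "\<lambda>g. g <# H"
  let ?p = "\<lambda>(g, k, l). (g, ?q k, ?q l)"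
  let ?TT = "prod_topology T (prod_topology T T)"
  have q: "open_map T ?C ?q" "continuous_map T ?C ?q"
    using open_map_coset[OF normal_imp_subgroup[OF H]]
      quotient_imp_continuous_map[OF quotient_map_coset[of H]]
    by auto
  have p_eq: "(\<lambda>(g, z). (g, (\<lambda>(k, l). (?q k, ?q l)) z)) = ?p"
    by auto
  have "open_map ?TT (prod_topology T (prod_topology ?C ?C)) (\<lambda>(g, z). (g, (\<lambda>(k, l). (?q k, ?q l)) z))"
    by (intro open_map_prod_topology q) (simp add: open_map_def)
  then have "open_map ?TT (prod_topology T (prod_topology ?C ?C)) ?p"
    unfolding p_eq .
  moreover
  have "continuous_map ?TT (prod_topology T (prod_topology ?C ?C)) (\<lambda>(g, z). (g, (\<lambda>(k, l). (?q k, ?q l)) z))"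
    using q by (simp add: continuous_map_prod_top)
  then have "continuous_map ?TT (prod_topology T (prod_topology ?C ?C)) ?p"
    unfolding p_eq .
  moreover have "?p ` topspace ?TT = topspace (prod_topology T (prod_topology ?C ?C))"
    by (force simp: topspace_coset_topology LCOSETS_def topspace_eq image_iff)
  ultimately have p: "quotient_map ?TT (prod_topology T (prod_topology ?C ?C)) ?p"
    using continuous_open_imp_quotient_map by blast
  have proj: "continuous_map ?TT T (\<lambda>z. fst z)" "continuous_map ?TT T (\<lambda>z. fst (snd z))"
      "continuous_map ?TT T (\<lambda>z. snd (snd z))"
    using continuous_map_fst continuous_map_snd
      continuous_map_compose[OF continuous_map_snd continuous_map_fst]
      continuous_map_compose[OF continuous_map_snd continuous_map_snd]
    by (fastforce simp: o_def)+
  have "continuous_map ?TT T (\<lambda>z. inv (fst (snd z)))"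
    using continuous_map_compose[OF proj(2) continuous_inv] by (simp add: o_def)
  then have "continuous_map ?TT T (\<lambda>(g, k, l). k \<otimes> g \<otimes> inv k \<otimes> l)"
    unfolding case_prod_unfold by (intro continuous_map_mult proj)
  from continuous_map_compose[OF this q(2)]
  have "continuous_map ?TT ?C ((\<lambda>(g, A, B). coset_action G H g A B) \<circ> ?p)"
    by (rule continuous_map_eq) (auto simp: topspace_eq coset_action_eq[OF H])
  then show ?case
    using p continuous_compose_quotient_map by blast
next
  case (2 g h A B)
  then obtain k l where kl: "k \<in> carrier G" "l \<in> carrier G" "A = k <# H" "B = l <# H"
    by (auto simp: topspace_coset_topology LCOSETS_def)
  have "k \<otimes> (g \<otimes> h) \<otimes> inv k \<otimes> l = k \<otimes> g \<otimes> inv k \<otimes> (k \<otimes> h \<otimes> inv k \<otimes> l)"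
    using 2 kl by (simp add: m_assoc inv_solve_left)
  then show ?case
    using 2 kl by (simp add: coset_action_eq[OF H])
next
  case (3 A B)
  then obtain k l where "k \<in> carrier G" "l \<in> carrier G" "A = k <# H" "B = l <# H"
    by (auto simp: topspace_coset_topology LCOSETS_def)
  then show ?case
    by (simp add: coset_action_eq[OF H])
qed

lemma distributive_action_coset:
  assumes H: "H \<lhd> G"
  shows "distributive_action G (coset_topology G T H) (coset_action G H)"
  unfolding distributive_action_def
proof (intro ballI)
  fix g h A B D
  assume gh: "g \<in> carrier G" "h \<in> carrier G" and "A \<in> topspace (coset_topology G T H)"
    "B \<in> topspace (coset_topology G T H)" "D \<in> topspace (coset_topology G T H)"
  then obtain k l m where kl: "k \<in> carrier G" "l \<in> carrier G" "m \<in> carrier G"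
      "A = k <# H" "B = l <# H" "D = m <# H"
    by (auto simp: topspace_coset_topology LCOSETS_def)
  define c where "c = k \<otimes> g \<otimes> inv k"
  have c: "c \<in> carrier G"
    using gh kl by (simp add: c_def)
  have inv_cancel: "inv a \<otimes> (a \<otimes> b) = b" "a \<otimes> (inv a \<otimes> b) = b"
    if "a \<in> carrier G" "b \<in> carrier G" for a b
    using that by (simp_all flip: m_assoc)
  have "c \<otimes> (l \<otimes> h \<otimes> inv l \<otimes> m) = (c \<otimes> l) \<otimes> h \<otimes> inv (c \<otimes> l) \<otimes> (c \<otimes> m)"
    using gh kl c by (simp add: m_assoc inv_mult_group inv_cancel)
  then show "coset_action G H g A (coset_action G H h B D) =
      coset_action G H h (coset_action G H g A B) (coset_action G H g A D)"
    using gh kl c by (simp add: coset_action_eq[OF H] flip: c_def)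
qed

end

end

theory Submission
  imports Defs
begin

text \<open>
  Fix a point \<open>x\<close> and let \<open>G\<close> act on \<open>X\<close> through the maps \<open>y \<mapsto> act g x y\<close>. This is an ordinary
  action, transitive by hypothesis, so \<open>X\<close> is as a set the space of left cosets of the stabilizer
  \<open>H\<close> of \<open>x\<close>. Distributivity says that each of these maps respects the binary action, and this has
  two consequences. First, an element of \<open>H\<close> fixes the base point, so it commutes with the whole
  action at \<open>x\<close> and fixes every point of the orbit of \<open>x\<close>; thus \<open>H\<close> is the kernel of the action on
  that orbit and is normal (\<open>normal_stabilizer_at\<close>). Second, the action at the point \<open>act k x x\<close> is the action at \<open>x\<close> conjugated by \<open>k\<close>
  (\<open>act_at_orbit_point\<close>), which is precisely the formula \<open>k g k\<^sup>-\<^sup>1 l\<close> for the action on cosets.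

  The topological part is that the orbit map \<open>g \<mapsto> act g x x\<close> is a quotient map. As \<open>X\<close> need only
  be T1, the usual argument about maps from a compact to a Hausdorff space does not apply. Instead,
  a translate \<open>C x\<close> of the point \<open>x\<close> by a closed set \<open>C\<close> is the set of all \<open>z\<close> for which some \<open>c\<close> in
  \<open>C\<close> moves \<open>z\<close> to \<open>x\<close> by its inverse, hence the projection to \<open>X\<close> of a closed subset of \<open>G \<times> X\<close>;
  projection along the compact factor \<open>G\<close> is a closed map (\<open>closed_map_orbit\<close>). The orbit map and
  the coset map are thus quotient maps with the same fibres, so their targets are homeomorphic.
\<close>

context binary_G_space
begin

lemma act_closed:
  assumes "g \<in> carrier G" "x \<in> topspace X" "y \<in> topspace X"
  shows "act g x y \<in> topspace X"
  using continuous_map_funspace[OF continuous_act] assms by (auto simp: topspace_eq Pi_iff)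

lemma act_inv_cancel:
  assumes "g \<in> carrier G" "x \<in> topspace X" "y \<in> topspace X"
  shows "act (inv g) x (act g x y) = y" "act g x (act (inv g) x y) = y"
  using assms act_mult[of "inv g" g x y] act_mult[of g "inv g" x y] by (simp_all add: act_one)

lemma continuous_map_act:
  assumes "continuous_map Z T a" "continuous_map Z X b" "continuous_map Z X c"
  shows "continuous_map Z X (\<lambda>z. act (a z) (b z) (c z))"
  using continuous_map_compose[OF _ continuous_act, of Z "\<lambda>z. (a z, b z, c z)"] assms
  by (simp add: o_def continuous_map_pairwise)

definition stabilizer_at :: "'x \<Rightarrow> 'a set" where
  "stabilizer_at x = {g \<in> carrier G. act g x x = x}"

lemma subgroup_stabilizer_at:
  assumes x: "x \<in> topspace X"
  shows "subgroup (stabilizer_at x) G"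
proof (rule subgroupI)
  show "stabilizer_at x \<noteq> {}"
    using x act_one by (auto simp: stabilizer_at_def)
  show "inv g \<in> stabilizer_at x" if "g \<in> stabilizer_at x" for g
    using that x act_inv_cancel(1)[of g x x] by (simp add: stabilizer_at_def)
qed (use x in \<open>auto simp: stabilizer_at_def act_mult\<close>)

lemma l_coset_stabilizer_at:
  assumes x: "x \<in> topspace X" and l: "l \<in> carrier G"
  shows "l <# stabilizer_at x = {g \<in> carrier G. act g x x = act l x x}"
proof (intro equalityI subsetI)
  show "g \<in> {g \<in> carrier G. act g x x = act l x x}" if "g \<in> l <# stabilizer_at x" for g
    using that x l by (auto simp: l_coset_def stabilizer_at_def act_mult)
next
  fix g
  assume "g \<in> {g \<in> carrier G. act g x x = act l x x}"
  then have g: "g \<in> carrier G" "act g x x = act l x x"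
    by auto
  then have "inv l \<otimes> g \<in> stabilizer_at x"
    using x l act_inv_cancel(1)[of l x x] by (simp add: stabilizer_at_def act_mult)
  moreover have "g = l \<otimes> (inv l \<otimes> g)"
    using g l by (simp flip: m_assoc)
  ultimately show "g \<in> l <# stabilizer_at x"
    by (auto simp: l_coset_def)
qed

lemma closedin_stabilizer_at:
  assumes "t1_space X" and x: "x \<in> topspace X"
  shows "closedin T (stabilizer_at x)"
proof -
  have "continuous_map T X (\<lambda>g. act g x x)"
    using x by (intro continuous_map_act) auto
  moreover have "closedin X {x}"
    using assms by (simp add: t1_space_closedin_singleton)
  ultimately have "closedin T {g \<in> topspace T. act g x x \<in> {x}}"
    by (rule closedin_continuous_map_preimage)
  then show ?thesis
    by (simp add: stabilizer_at_def topspace_eq)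
qed

text \<open>Being moved from \<open>x\<close> to \<open>z\<close> by \<open>c\<close> is read backwards, as being moved from \<open>z\<close> to \<open>x\<close> by the
  inverse of \<open>c\<close>. For fixed \<open>x\<close> this is a closed condition on \<open>(c, z)\<close> as soon as \<open>{x}\<close> is closed,
  whereas the graph of the orbit map is known to be closed only for Hausdorff \<open>X\<close>.\<close>

lemma closed_map_orbit:
  assumes compact: "compact_space T" and t1: "t1_space X" and x: "x \<in> topspace X"
  shows "closed_map T X (\<lambda>g. act g x x)"
  unfolding closed_map_def
proof (intro allI impI)
  fix C
  assume C: "closedin T C"
  then have CG: "C \<subseteq> carrier G"
    using closedin_subset topspace_eq by blast
  let ?P = "prod_topology T X"
  let ?S = "{p \<in> topspace ?P. fst p \<in> C} \<inter> {p \<in> topspace ?P. act (inv (fst p)) x (snd p) \<in> {x}}"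
  have inv_fst: "continuous_map ?P T (\<lambda>p. inv (fst p))"
    using continuous_map_compose[OF continuous_map_fst continuous_inv] by (simp add: o_def)
  have "continuous_map ?P X (\<lambda>p. act (inv (fst p)) x (snd p))"
    using x by (intro continuous_map_act inv_fst continuous_map_snd) auto
  then have "closedin ?P ?S"
    using C t1 x
    by (intro closedin_Int closedin_continuous_map_preimage[OF continuous_map_fst]
        closedin_continuous_map_preimage[where Y = X])
      (auto simp: t1_space_closedin_singleton)
  moreover have "closed_map ?P X snd"
    using compact by (rule closed_map_snd)
  ultimately have "closedin X (snd ` ?S)"
    unfolding closed_map_def by blast
  moreover have "snd ` ?S = (\<lambda>g. act g x x) ` C"
  proof (intro equalityI subsetI)
    fix z
    assume "z \<in> snd ` ?S"
    then obtain c where c: "c \<in> C" "z \<in> topspace X" "act (inv c) x z = x"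
      by auto
    then have "z = act c x x"
      using act_inv_cancel(2)[of c x z] CG x by auto
    then show "z \<in> (\<lambda>g. act g x x) ` C"
      using c by blast
  next
    fix z
    assume "z \<in> (\<lambda>g. act g x x) ` C"
    then obtain c where c: "c \<in> C" "z = act c x x"
      by blast
    then have "(c, z) \<in> ?S"
      using CG x act_inv_cancel(1)[of c x x] by (auto simp: topspace_eq act_closed)
    then show "z \<in> snd ` ?S"
      by force
  qed
  ultimately show "closedin X ((\<lambda>g. act g x x) ` C)"
    by simp
qed

lemma quotient_map_orbit:
  assumes "compact_space T" "t1_space X" "transitive_action G X act" "x \<in> topspace X"
  shows "quotient_map T X (\<lambda>g. act g x x)"
proof (rule continuous_closed_imp_quotient_map)
  show "continuous_map T X (\<lambda>g. act g x x)"
    using assms by (intro continuous_map_act) auto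
qed (use assms in \<open>auto simp: closed_map_orbit transitive_action_def topspace_eq\<close>)

text \<open>Distributivity moves \<open>k\<close> past \<open>g\<close> at the price of moving the base point of the action of \<open>g\<close>
  from \<open>x\<close> to \<open>act k x x\<close>; applied to \<open>inv k \<otimes> l\<close> it gives the conjugation.\<close>

lemma act_at_orbit_point:
  assumes dist: "distributive_action G X act" and x: "x \<in> topspace X"
    and g: "g \<in> carrier G" and k: "k \<in> carrier G" and l: "l \<in> carrier G"
  shows "act g (act k x x) (act l x x) = act (k \<otimes> g \<otimes> inv k \<otimes> l) x x"
proof -
  have y: "act (inv k \<otimes> l) x x \<in> topspace X"
    using x k l by (simp add: act_closed)
  have "act (k \<otimes> g \<otimes> inv k \<otimes> l) x x = act (k \<otimes> (g \<otimes> (inv k \<otimes> l))) x x"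
    using g k l by (simp add: m_assoc)
  also have "\<dots> = act k x (act g x (act (inv k \<otimes> l) x x))"
    using x g k l by (simp add: act_mult act_closed)
  also have "\<dots> = act g (act k x x) (act k x (act (inv k \<otimes> l) x x))"
    using dist x g k y by (auto simp: distributive_action_def)
  also have "act k x (act (inv k \<otimes> l) x x) = act l x x"
    using x k l by (simp add: act_mult act_closed act_inv_cancel)
  finally show ?thesis
    by simp
qed

text \<open>For \<open>h\<close> in the stabilizer, moving the base point along \<open>h\<close> changes nothing, so \<open>h\<close> commutes
  with every \<open>g\<close> and fixes all the points \<open>act g x x\<close>, not only \<open>x\<close>. Fixing the point with
  \<open>inv g\<close> in place of \<open>g\<close> is what the conjugate of \<open>h\<close> by \<open>g\<close> needs in order to fix \<open>x\<close>.\<close>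

lemma normal_stabilizer_at:
  assumes dist: "distributive_action G X act" and x: "x \<in> topspace X"
  shows "stabilizer_at x \<lhd> G"
  unfolding normal_inv_iff
proof (intro conjI ballI subgroup_stabilizer_at x)
  fix g h
  assume g: "g \<in> carrier G" and h: "h \<in> stabilizer_at x"
  have h': "h \<in> carrier G" "act h x x = x"
    using h by (auto simp: stabilizer_at_def)
  have "act h x (act (inv g) x x) = act (inv g) (act h x x) (act h x x)"
    using dist x g h' by (auto simp: distributive_action_def)
  then have "act h x (act (inv g) x x) = act (inv g) x x"
    by (simp add: h')
  then have "act (g \<otimes> h \<otimes> inv g) x x = x"
    using x g h' by (simp add: act_mult act_closed act_inv_cancel)
  then show "g \<otimes> h \<otimes> inv g \<in> stabilizer_at x"
    using g h' by (simp add: stabilizer_at_def)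
qed

text \<open>The inverse of \<open>g H \<mapsto> act g x x\<close> is the map taking a point to its transporter set from \<open>x\<close>,
  which is a coset of the stabilizer.\<close>

theorem biequivariantly_homeomorphic_coset:
  assumes compact: "compact_space T" and t1: "t1_space X"
    and dist: "distributive_action G X act" and trans: "transitive_action G X act"
    and x: "x \<in> topspace X"
  defines "H \<equiv> stabilizer_at x"
  shows "biequivariantly_homeomorphic G X act (coset_topology G T H) (coset_action G H)"
proof -
  let ?C = "coset_topology G T H"
  define f where "f y = {g \<in> carrier G. act g x x = y}" for y
  have f: "f (act l x x) = l <# H" if "l \<in> carrier G" for l
    using that x by (simp add: f_def H_def l_coset_stabilizer_at)
  have orbit: "\<exists>l\<in>carrier G. y = act l x x" if "y \<in> topspace X" for y
    using that trans x unfolding transitive_action_def by blast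
  have q: "quotient_map T X (\<lambda>g. act g x x)"
    using compact t1 trans x by (rule quotient_map_orbit)
  have comp: "quotient_map T ?C (f \<circ> (\<lambda>g. act g x x))"
    by (rule quotient_map_eq[OF quotient_map_coset]) (simp add: f topspace_eq)
  have cont: "continuous_map X ?C f"
    using q quotient_imp_continuous_map[OF comp] by (rule continuous_compose_quotient_map)
  have "quotient_map X ?C f"
    using quotient_imp_continuous_map[OF q] cont comp by (rule quotient_map_from_composition)
  moreover have "inj_on f (topspace X)"
    using orbit by (fastforce simp: inj_on_def f_def)
  ultimately have "homeomorphic_map X ?C f"
    by (simp add: homeomorphic_map_def)
  moreover have "f (act g y z) = coset_action G H g (f y) (f z)"
    if g: "g \<in> carrier G" and yz: "y \<in> topspace X" "z \<in> topspace X" for g y z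
  proof -
    obtain k l where kl: "k \<in> carrier G" "y = act k x x" "l \<in> carrier G" "z = act l x x"
      using orbit yz by meson
    have "H \<lhd> G"
      unfolding H_def using dist x by (rule normal_stabilizer_at)
    then show ?thesis
      using g kl dist x by (simp add: f coset_action_eq act_at_orbit_point)
  qed
  ultimately show ?thesis
    using cont unfolding biequivariantly_homeomorphic_def biequivariant_map_def by blast
qed

end

theorem theorem4p7:
  fixes G :: "('a, 'm) monoid_scheme" and T :: "'a topology"
    and X :: "'x topology" and act :: "'a \<Rightarrow> 'x \<Rightarrow> 'x \<Rightarrow> 'x"
  assumes "topological_group G T" and "compact_space T"
    and "t1_space X" and "topspace X \<noteq> {}"
    and "binary_G_space G T X act"
    and "distributive_action G X act"
    and "transitive_action G X act"
  shows "\<exists>H. H \<lhd> G \<and> closedin T H \<and>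
    biequivariantly_homeomorphic G X act (coset_topology G T H) (coset_action G H)"
proof -
  interpret binary_G_space G T X act
    by (rule assms)
  obtain x where "x \<in> topspace X"
    using assms by blast
  then show ?thesis
    using assms normal_stabilizer_at closedin_stabilizer_at biequivariantly_homeomorphic_coset
    by blast
qed

end
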